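(* If $v$ and $w$ are real numbers such that $|w/v|\le1$, then $$\begin{aligned}-4\,\mathrm{T}(v,w)=\;&2\mathrm{Li}_3\left(\frac wv\right)-2\mathrm{Li}_3\left(-\frac wv\right)+\mathrm{Li}_3\left(\frac{1-vi}{1-wi}\right)+\mathrm{Li}_3\left(\frac{1+vi}{1+wi}\right)\\&-\mathrm{Li}_3\left(\frac{1+vi}{1-wi}\right)-\mathrm{Li}_3\left(\frac{1-vi}{1+wi}\right)-\mathrm{Li}_3\left(\frac{w(1-vi)}{v(1-wi)}\right)-\mathrm{Li}_3\left(\frac{w(1+vi)}{v(1+wi)}\right)\\&+\mathrm{Li}_3\left(-\frac{w(1+vi)}{v(1-wi)}\right)+\mathrm{Li}_3\left(-\frac{w(1-vi)}{v(1+wi)}\right)\\&+\log\left(\frac{1+v^2}{1+w^2}\right)\left(\mathrm{Li}_2\left(\frac wv\right)-\mathrm{Li}_2\left(-\frac wv\right)\right)\\&-4\tan^{-1}(v)\left(\frac{\mathrm{Li}_2(wi)-\mathrm{Li}_2(-wi)}{2i}\right)-4\tan^{-1}(w)\left(\frac{\mathrm{Li}_2(vi)-\mathrm{Li}_2(-vi)}{2i}\right)\\&-\pi\log\left(\frac{1+v^2}{1+w^2}\right)\tan^{-1}(w)+4\log(v)\tan^{-1}(v)\tan^{-1}(w).\end{aligned}$$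
   Context: The function $\mathrm{T}$ is defined by $\mathrm{T}(v,w)=\int_0^1\frac{\tan^{-1}(vx)\tan^{-1}(wx)}{x}\,dx$. The polylogarithm of order $k$ is $\mathrm{Li}_k(z)=\sum_{n=1}^{\infty}z^n/n^k$ for $|z|<1$, and is understood by analytic continuation (and by continuity at $z=1$ for $k=2,3$) elsewhere; $i=\sqrt{-1}$.
   Formalization: The formal statement assumes v > 0: for v < 0 the term log(v) is not a real number, and the identity fails with the principal logarithm whenever w ≠ 0 (e.g. v = −1, w = 1/2), and with log|v| whenever 0 < |w| < |v|. *)

theory Defs
  imports "HOL-Complex_Analysis.Complex_Analysis"
begin

definition T_fun :: "real \<Rightarrow> real \<Rightarrow> real" where
  "T_fun v w = integral {0..1} (\<lambda>x. arctan (v * x) * arctan (w * x) / x)"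

text \<open>
  The series of the polylogarithm of order k starts at exponent 1, hence the shift by
  \<^const>\<open>Suc\<close>. Its analytic continuation is taken on the plane cut along the real half-line from
  1 to infinity (the principal branch).
\<close>

definition slit_plane :: "complex set" where
  "slit_plane = - (complex_of_real ` {1..})"

definition is_polylog_continuation :: "nat \<Rightarrow> (complex \<Rightarrow> complex) \<Rightarrow> bool" where
  "is_polylog_continuation k f \<longleftrightarrow>
     f holomorphic_on slit_plane \<and>
     (\<forall>z. norm z < 1 \<longrightarrow> (\<lambda>n. z ^ Suc n / of_nat (Suc n) ^ k) sums f z)"

definition polylog_continuation :: "nat \<Rightarrow> complex \<Rightarrow> complex" where
  "polylog_continuation k = (SOME f. is_polylog_continuation k f)"

text \<open>
  At the branch point 1 the value is the limit from within the cut plane, which exists for orders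
  at least 2. At the points of the cut beyond 1 there is no such limit for positive orders, and the
  value there carries no meaning.
\<close>

definition polylog :: "nat \<Rightarrow> complex \<Rightarrow> complex" where
  "polylog k z =
     (if z \<in> slit_plane then polylog_continuation k z
      else Lim (at z within slit_plane) (polylog_continuation k))"

text \<open>The continuation exists and is unique, so the choice above is immaterial.\<close>

lemma slit_plane_iff: "z \<in> slit_plane \<longleftrightarrow> \<not> (Im z = 0 \<and> 1 \<le> Re z)"
  by (force simp: slit_plane_def image_iff complex_eq_iff)

lemma zero_in_slit_plane: "0 \<in> slit_plane"
  by (simp add: slit_plane_iff)

lemma ball_subset_slit_plane: "norm z < 1 \<Longrightarrow> z \<in> slit_plane"
  using abs_Re_le_cmod[of z] by (auto simp: slit_plane_iff)

lemma open_slit_plane: "open slit_plane"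
proof -
  have "slit_plane = - ({z. Im z = 0} \<inter> {z. 1 \<le> Re z})"
    by (auto simp: slit_plane_iff)
  moreover have "closed ({z. Im z = 0} \<inter> {z. 1 \<le> Re z})"
    by (intro closed_Int closed_Collect_eq closed_Collect_le continuous_intros)
  ultimately show ?thesis unfolding open_closed by (metis double_complement)
qed

lemma closed_segment_slit_plane:
  assumes "z \<in> slit_plane" shows "closed_segment 0 z \<subseteq> slit_plane"
proof
  fix y assume "y \<in> closed_segment 0 z"
  then obtain u where u: "0 \<le> u" "u \<le> 1" "y = of_real u * z"
    by (auto simp: closed_segment_def scaleR_conv_of_real)
  show "y \<in> slit_plane"
  proof (rule ccontr)
    assume "y \<notin> slit_plane"
    then have *: "u * Im z = 0" "1 \<le> u * Re z" using u by (auto simp: slit_plane_iff)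
    then have "u \<noteq> 0" by auto
    moreover have "1 \<le> Re z"
    proof -
      have "0 < Re z" using * u by (smt (verit) mult_nonneg_nonpos)
      then have "u * Re z \<le> 1 * Re z" using u by (intro mult_right_mono) auto
      then show ?thesis using * by simp
    qed
    ultimately show False using * assms by (auto simp: slit_plane_iff)
  qed
qed

lemma starlike_slit_plane: "starlike slit_plane"
  unfolding starlike_def using zero_in_slit_plane closed_segment_slit_plane by blast

lemma is_polylog_continuation_exists: "\<exists>f. is_polylog_continuation k f"
proof (induction k)
  case 0
  have "(\<lambda>z. z / (1 - z)) holomorphic_on slit_plane"
    by (intro holomorphic_intros) (auto simp: slit_plane_iff)
  moreover have "(\<lambda>n. z ^ Suc n / of_nat (Suc n) ^ 0) sums (z / (1 - z))" if "norm z < 1" for z :: complex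
    using sums_mult[OF geometric_sums[OF that], of z] by simp
  ultimately show ?case unfolding is_polylog_continuation_def by blast
next
  case (Suc k)
  obtain f where hol: "f holomorphic_on slit_plane"
    and sums: "\<And>z. norm z < 1 \<Longrightarrow> (\<lambda>n. z ^ Suc n / of_nat (Suc n) ^ k) sums f z"
    using Suc.IH unfolding is_polylog_continuation_def by blast
  have f0: "f 0 = 0" using sums[of 0] by (simp add: sums_iff)
  define g where "g = (\<lambda>z. if z = 0 then deriv f 0 else f z / z)"
  have "g holomorphic_on slit_plane"
    by (rule pole_theorem_open_0[OF hol open_slit_plane, of 0]) (auto simp: g_def f0)
  then obtain h0 where h0: "\<And>z. z \<in> slit_plane \<Longrightarrow> (h0 has_field_derivative g z) (at z)"
    using holomorphic_starlike_primitive[OF holomorphic_on_imp_continuous_on starlike_slit_plane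
        open_slit_plane finite.emptyI, of g] open_slit_plane
    by (auto simp: holomorphic_on_imp_differentiable_at)
  define h where "h = (\<lambda>z. h0 z - h0 0)"
  have h: "(h has_field_derivative g z) (at z)" if "z \<in> slit_plane" for z
    unfolding h_def by (auto intro!: derivative_eq_intros h0 that)
  have hol_h: "h holomorphic_on slit_plane"
    using h open_slit_plane by (auto simp: holomorphic_on_open)
  define c where "c = (\<lambda>n. if n = 0 then 0 else 1 / of_nat n ^ Suc k :: complex)"
  have c_summable: "summable (\<lambda>n. c n * z ^ n)" if "norm z < 1" for z
  proof (rule summable_comparison_test[OF _ summable_geometric[of "norm z"]])
    have "norm (c n) \<le> 1" for n
      by (auto simp: c_def norm_divide norm_power norm_mult divide_simps
          simp del: power_Suc of_nat_Suc intro!: one_le_power)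
    then show "\<exists>N. \<forall>n\<ge>N. norm (c n * z ^ n) \<le> norm z ^ n"
      by (auto simp: norm_mult norm_power intro!: mult_left_le_one_le)
  qed (use that in auto)
  define F where "F = (\<lambda>z. \<Sum>n. c n * z ^ n)"
  have dc: "diffs c n = 1 / of_nat (Suc n) ^ k" for n
    by (simp add: diffs_def c_def field_simps del: of_nat_Suc)
  have F: "(F has_field_derivative g z) (at z)" if z: "norm z < 1" for z
  proof -
    have "(F has_field_derivative (\<Sum>n. diffs c n * z ^ n)) (at z)"
      unfolding F_def using c_summable z by (rule termdiffs_strong')
    moreover have "(\<Sum>n. diffs c n * z ^ n) = g z" if "z \<noteq> 0"
    proof -
      have "(\<lambda>n. diffs c n * z ^ n) sums (f z / z)"
        using sums_divide[OF sums[OF z], of z] that by (simp add: dc del: of_nat_Suc)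
      then show ?thesis using that by (simp add: g_def sums_iff)
    qed
    moreover have "(\<Sum>n. diffs c n * z ^ n) = g z" if "z = 0"
    proof -
      have "(f has_field_derivative 1) (at 0)"
      proof -
        define d where "d = (\<lambda>n. if n = 0 then 0 else 1 / of_nat n ^ k :: complex)"
        have d_sums: "(\<lambda>n. d n * y ^ n) sums f y" if "norm y < 1" for y
          using sums[OF that]
          using sums_Suc_iff[of "\<lambda>n. d n * y ^ n" "f y"]
          by (simp add: d_def del: power_Suc of_nat_Suc)
        have "((\<lambda>y. \<Sum>n. d n * y ^ n) has_field_derivative (\<Sum>n. diffs d n * 0 ^ n)) (at 0)"
          using d_sums by (intro termdiffs_strong'[where K = 1]) (auto simp: sums_iff)
        moreover have "(\<Sum>n. diffs d n * 0 ^ n) = 1"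
          by (subst powser_zero) (simp add: diffs_def d_def)
        ultimately show ?thesis
          using has_field_derivative_transform_within_open[of _ 1 0 "ball 0 1" f] d_sums
          by (simp add: sums_iff)
      qed
      then have "g 0 = 1" by (simp add: g_def DERIV_imp_deriv)
      moreover have "(\<Sum>n. diffs c n * 0 ^ n) = 1"
        by (subst powser_zero) (simp add: dc)
      ultimately show ?thesis using that by metis
    qed
    ultimately show ?thesis by (cases "z = 0") simp_all
  qed
  have F_eq: "F z = h z" if z: "norm z < 1" for z
  proof -
    have "((\<lambda>y. F y - h y) has_field_derivative 0) (at y within ball 0 1)" if "y \<in> ball 0 1" for y
    proof -
      have "norm y < 1" using that by simp
      from DERIV_diff[OF F[OF this] h[OF ball_subset_slit_plane[OF this]]] show ?thesis
        by (simp add: has_field_derivative_at_within)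
    qed
    then obtain e where e: "\<And>y. y \<in> ball 0 1 \<Longrightarrow> F y - h y = e"
      using has_field_derivative_zero_constant[OF convex_ball, of 0 1 "\<lambda>y. F y - h y"] by blast
    have "F 0 = 0" unfolding F_def by (subst powser_zero) (simp add: c_def)
    then have "e = 0" using e[of 0] by (simp add: h_def)
    then show ?thesis using e[of z] z by simp
  qed
  have "(\<lambda>n. z ^ Suc n / of_nat (Suc n) ^ Suc k) sums h z" if z: "norm z < 1" for z
  proof -
    have "(\<lambda>n. c n * z ^ n) sums h z"
      using c_summable[OF z] F_eq[OF z] by (simp add: F_def sums_iff)
    then show ?thesis
      using sums_Suc_iff[of "\<lambda>n. c n * z ^ n" "h z"]
      by (simp add: c_def del: power_Suc of_nat_Suc)
  qed
  with hol_h show ?case unfolding is_polylog_continuation_def by blast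
qed

lemma is_polylog_continuation_unique:
  assumes "is_polylog_continuation k f" "is_polylog_continuation k g" "z \<in> slit_plane"
  shows "f z = g z"
proof -
  have "f y = g y" if "y \<in> ball 0 1" for y
    using assms that sums_unique2 unfolding is_polylog_continuation_def by fastforce
  then show ?thesis
    using assms open_slit_plane starlike_imp_connected[OF starlike_slit_plane] ball_subset_slit_plane
    by (intro analytic_continuation_open[of "ball 0 1" slit_plane f g z])
       (auto simp: is_polylog_continuation_def)
qed

lemma polylog_continuation: "is_polylog_continuation k (polylog_continuation k)"
  unfolding polylog_continuation_def using is_polylog_continuation_exists by (rule someI_ex)

end

theory Submission
  imports Defs "HOL-Real_Asymp.Real_Asymp"
begin

text \<open>
  Replacing \<open>(v, w)\<close> by \<open>(tv, tw)\<close> turns \<open>T\<close> into the integral over \<open>[0, t]\<close> of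
  \<open>arctan (vx) arctan (wx) / x\<close>, while the ratio \<open>w/v\<close> stays fixed. So it suffices that the
  right-hand side, as a function of \<open>t\<close>, vanishes at 0 and has the derivative
  \<open>-4 arctan (vt) arctan (wt) / t\<close>. The dilogarithms in that derivative are eliminated by a
  five-term relation, used for the four sign choices of \<open>(\<plusminus>v, \<plusminus>w)\<close>; it is proved in the same way,
  since its derivative in \<open>t\<close> involves only logarithms. The limits \<open>t \<rightarrow> 0\<close> need the continuity of
  \<open>Li\<^sub>2\<close> and \<open>Li\<^sub>3\<close> at the branch point 1.
\<close>

section \<open>Polylogarithms on the cut plane\<close>

lemma polylog_slit_plane: "z \<in> slit_plane \<Longrightarrow> polylog k z = polylog_continuation k z"
  by (simp add: polylog_def)

lemma holomorphic_on_polylog_continuation: "polylog_continuation k holomorphic_on slit_plane"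
  using polylog_continuation unfolding is_polylog_continuation_def by blast

lemma polylog_continuation_sums:
  "norm z < 1 \<Longrightarrow> (\<lambda>n. z ^ Suc n / of_nat (Suc n) ^ k) sums polylog_continuation k z"
  using polylog_continuation unfolding is_polylog_continuation_def by blast

lemma polylog_eqI:
  "is_polylog_continuation k f \<Longrightarrow> z \<in> slit_plane \<Longrightarrow> polylog k z = f z"
  by (metis is_polylog_continuation_unique polylog_continuation polylog_slit_plane)

lemma polylog_0 [simp]: "polylog k 0 = 0"
  using polylog_continuation_sums[of 0 k] zero_in_slit_plane
  by (simp add: polylog_slit_plane sums_iff)

lemma polylog_1:
  assumes "z \<in> slit_plane" shows "polylog 1 z = - Ln (1 - z)"
proof (rule polylog_eqI[OF _ assms])
  have "(\<lambda>z. - Ln (1 - z)) holomorphic_on slit_plane"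
    by (intro holomorphic_intros) (auto simp: slit_plane_iff complex_nonpos_Reals_iff)
  moreover have "(\<lambda>n. z ^ Suc n / of_nat (Suc n) ^ 1) sums - Ln (1 - z)" if "norm z < 1" for z
  proof -
    have "(\<lambda>n. z ^ n / of_nat n) sums - Ln (1 - z)"
      using sums_minus[OF Ln_series'[of "- z"]] that by simp
    then show ?thesis
      using sums_Suc_iff[of "\<lambda>n. z ^ n / of_nat n" "- Ln (1 - z)"]
      by (simp del: power_Suc of_nat_Suc)
  qed
  ultimately show "is_polylog_continuation 1 (\<lambda>z. - Ln (1 - z))"
    unfolding is_polylog_continuation_def by blast
qed

text \<open>On the disc this is termwise differentiation. Phrased as a continuation of order
  \<open>k\<close>, it extends by uniqueness to \<open>z * Li_(k+1)'(z) = Li_k(z)\<close> on the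
  whole cut plane.\<close>

lemma is_polylog_continuation_deriv:
  "is_polylog_continuation k (\<lambda>z. z * deriv (polylog_continuation (Suc k)) z)"
  unfolding is_polylog_continuation_def
proof (intro conjI allI impI)
  show "(\<lambda>z. z * deriv (polylog_continuation (Suc k)) z) holomorphic_on slit_plane"
    by (intro holomorphic_intros holomorphic_on_polylog_continuation open_slit_plane)
next
  fix z :: complex assume z: "norm z < 1"
  \<comment> \<open>The coefficient at index 0 is \<open>1 / 0 = 0\<close>, so this power series is
    the shifted series of the polylogarithm.\<close>
  define c where "c = (\<lambda>n. 1 / of_nat n ^ Suc k :: complex)"
  have sums: "(\<lambda>n. c n * y ^ n) sums polylog_continuation (Suc k) y" if "norm y < 1" for y
    using polylog_continuation_sums[OF that, of "Suc k"]
      sums_Suc_iff[of "\<lambda>n. c n * y ^ n" "polylog_continuation (Suc k) y"]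
    by (simp add: c_def del: of_nat_Suc)
  have dc: "diffs c n = 1 / of_nat (Suc n) ^ k" for n
    by (simp add: diffs_def c_def field_simps del: of_nat_Suc)
  have "((\<lambda>y. \<Sum>n. c n * y ^ n) has_field_derivative (\<Sum>n. diffs c n * z ^ n)) (at z)"
    using sums z by (intro termdiffs_strong'[where K = 1]) (auto simp: sums_iff)
  then have "(polylog_continuation (Suc k) has_field_derivative (\<Sum>n. diffs c n * z ^ n)) (at z)"
    by (rule has_field_derivative_transform_within_open[of _ _ _ "ball 0 1"])
       (use sums z in \<open>auto simp: sums_iff\<close>)
  then have "deriv (polylog_continuation (Suc k)) z = (\<Sum>n. diffs c n * z ^ n)"
    by (rule DERIV_imp_deriv)
  moreover have "summable (\<lambda>n. diffs c n * z ^ n)"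
    using sums z by (intro termdiff_converges[where K = 1]) (auto simp: sums_iff)
  ultimately have "(\<lambda>n. diffs c n * z ^ n) sums deriv (polylog_continuation (Suc k)) z"
    by (simp add: sums_iff)
  from sums_mult[OF this, of z]
  show "(\<lambda>n. z ^ Suc n / of_nat (Suc n) ^ k) sums (z * deriv (polylog_continuation (Suc k)) z)"
    by (simp add: dc del: of_nat_Suc)
qed

text \<open>The derivative is kept as \<open>deriv\<close> since division by \<open>z\<close> would
  exclude 0, an argument that occurs when \<open>w = 0\<close>.\<close>

lemma has_field_derivative_polylog:
  assumes "z \<in> slit_plane"
  shows "(polylog (Suc k) has_field_derivative deriv (polylog_continuation (Suc k)) z) (at z)"
proof (rule has_field_derivative_transform_within_open)
  show "(polylog_continuation (Suc k) has_field_derivative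
      deriv (polylog_continuation (Suc k)) z) (at z)"
    using assms by (intro holomorphic_derivI[OF holomorphic_on_polylog_continuation open_slit_plane])
qed (use assms open_slit_plane in \<open>auto simp: polylog_slit_plane\<close>)

lemma deriv_polylog_continuation:
  "z \<in> slit_plane \<Longrightarrow> z * deriv (polylog_continuation (Suc k)) z = polylog k z"
  using polylog_eqI[OF is_polylog_continuation_deriv] by metis

lemma has_field_derivative_polylog':
  assumes "z \<in> slit_plane" "z \<noteq> 0"
  shows "(polylog (Suc k) has_field_derivative polylog k z / z) (at z)"
  using has_field_derivative_polylog[OF assms(1)] assms deriv_polylog_continuation[OF assms(1)]
  by (metis nonzero_mult_div_cancel_left)

section \<open>Limits at the branch point 1\<close>

text \<open>\<open>g\<close> has a primitive \<open>H\<close> on the full disc around 1, and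
  \<open>\<Phi> - H\<close> has derivative 0 on the connected slit disc, hence is constant there. So
  \<open>\<Phi>\<close> inherits a limit at 1 from the continuity of \<open>H\<close>.\<close>

lemma tendsto_1_within_slit_plane:
  assumes g: "g holomorphic_on ball 1 1"
    and \<Phi>: "\<And>z. z \<in> slit_plane \<inter> ball 1 1 \<Longrightarrow> (\<Phi> has_field_derivative g z) (at z)"
  shows "\<exists>l. (\<Phi> \<longlongrightarrow> l) (at 1 within slit_plane)"
proof -
  define S where "S = slit_plane \<inter> ball 1 (1 :: real)"
  have [simp]: "open S" unfolding S_def using open_slit_plane by auto
  obtain H where H: "\<And>z. z \<in> ball 1 1 \<Longrightarrow> (H has_field_derivative g z) (at z)"
    using holomorphic_convex_primitive'[OF convex_ball open_ball g] at_within_open[OF _ open_ball]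
    by metis
  \<comment> \<open>The slit disc is star-shaped about 1/2, which gives the connectedness of
    \<open>S\<close>.\<close>
  have "closed_segment (1/2) z \<subseteq> S" if z: "z \<in> S" for z
  proof
    fix y assume y: "y \<in> closed_segment (1/2) z"
    then obtain u where u: "0 \<le> u" "u \<le> 1" "y = (1 - u) *\<^sub>R (1/2) + u *\<^sub>R z"
      by (auto simp: closed_segment_def)
    have "y \<in> ball 1 1"
      using closed_segment_subset[of "1/2" "ball (1::complex) 1" z] y z
      by (auto simp: S_def dist_norm)
    moreover have "y \<in> slit_plane"
    proof (rule ccontr)
      assume "y \<notin> slit_plane"
      then have *: "u * Im z = 0" "1 \<le> (1 - u) / 2 + u * Re z"
        using u by (auto simp: slit_plane_iff)
      then have "u \<noteq> 0" by auto
      then have "Im z = 0" using * by auto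
      then have "Re z < 1" using z by (auto simp: S_def slit_plane_iff)
      then have "u * Re z \<le> u * 1" using u by (intro mult_left_mono) auto
      then have "u = 1" using * u by argo
      then show False using * \<open>Re z < 1\<close> by simp
    qed
    ultimately show "y \<in> S" by (simp add: S_def)
  qed
  moreover have "1/2 \<in> S" by (auto simp: S_def slit_plane_iff dist_norm)
  ultimately have "connected S"
    by (intro starlike_imp_connected) (auto simp: starlike_def)
  have D: "((\<lambda>z. \<Phi> z - H z) has_field_derivative 0) (at z)" if "z \<in> S" for z
    using DERIV_diff[OF \<Phi>[of z] H[of z]] that by (simp add: S_def)
  obtain c where c: "\<And>z. z \<in> S \<Longrightarrow> \<Phi> z - H z = c"
    using has_field_derivative_0_imp_constant_on[OF D \<open>connected S\<close> \<open>open S\<close>]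
    unfolding constant_on_def by blast
  have "(H \<longlongrightarrow> H 1) (at 1)"
    using DERIV_isCont[OF H[of 1]] by (simp add: isCont_def)
  then have "(H \<longlongrightarrow> H 1) (at 1 within slit_plane)"
    by (rule tendsto_within_subset) simp
  then have "((\<lambda>z. H z + c) \<longlongrightarrow> H 1 + c) (at 1 within slit_plane)"
    by (intro tendsto_intros)
  moreover have "\<forall>\<^sub>F z in at 1 within slit_plane. H z + c = \<Phi> z"
    unfolding eventually_at
    by (rule exI[of _ 1]) (use c in \<open>auto simp: S_def dist_commute algebra_simps\<close>)
  ultimately have "(\<Phi> \<longlongrightarrow> H 1 + c) (at 1 within slit_plane)"
    by (rule Lim_transform_eventually)
  then show ?thesis by blast
qed

text \<open>The imaginary part of \<open>Ln\<close> is bounded by \<open>pi\<close>, so the claim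
  reduces to a limit in the real variable \<open>norm z\<close>, and \<open>z\<close> may cross the
  branch cut.\<close>

lemma tendsto_mult_Ln_0: "((\<lambda>z. z * Ln z) \<longlongrightarrow> 0) (at 0)"
proof (rule Lim_null_comparison)
  have "norm (z * Ln z) \<le> norm z * (\<bar>ln (norm z)\<bar> + pi)" if "z \<noteq> 0" for z
  proof -
    have "norm (Ln z) \<le> \<bar>Re (Ln z)\<bar> + \<bar>Im (Ln z)\<bar>" by (rule cmod_le)
    also have "\<dots> \<le> \<bar>ln (norm z)\<bar> + pi"
      using that mpi_less_Im_Ln[OF that] Im_Ln_le_pi[OF that] by auto
    finally show ?thesis by (simp add: norm_mult mult_left_mono)
  qed
  then show "\<forall>\<^sub>F z in at 0. norm (z * Ln z) \<le> norm z * (\<bar>ln (norm z)\<bar> + pi)"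
    by (auto simp: eventually_at_filter)
  have "((\<lambda>x. x * (\<bar>ln x\<bar> + pi)) \<longlongrightarrow> 0) (at_right (0::real))" by real_asymp
  moreover have "filterlim norm (at_right 0) (at (0::complex))"
    unfolding filterlim_at by (auto intro!: tendsto_eq_intros simp: eventually_at_filter)
  ultimately show "((\<lambda>z::complex. norm z * (\<bar>ln (norm z)\<bar> + pi)) \<longlongrightarrow> 0) (at 0)"
    by (rule filterlim_compose)
qed

lemma ball_1_nonpos_Reals: "(z :: complex) \<in> ball 1 1 \<Longrightarrow> z \<notin> \<real>\<^sub>\<le>\<^sub>0"
  using abs_Re_le_cmod[of "1 - z"] by (auto simp: complex_nonpos_Reals_iff dist_norm)

text \<open>The removable singularity at 1 is filled in; on the slit disc around 1 this is the
  derivative of the regularised dilogarithm \<open>polylog 2 z + Ln z * Ln (1 - z)\<close>.\<close>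

definition Ln_slope :: "complex \<Rightarrow> complex" where
  "Ln_slope z = (if z = 1 then 1 else Ln z / (z - 1))"

lemma Ln_slope: "(z - 1) * Ln_slope z = Ln z"
  by (simp add: Ln_slope_def)

lemma holomorphic_Ln_slope: "Ln_slope holomorphic_on ball 1 1"
proof (rule pole_theorem_open_0)
  show "Ln holomorphic_on ball 1 1"
    by (intro holomorphic_intros) (auto dest: ball_1_nonpos_Reals)
  show "Ln_slope 1 = deriv Ln 1"
    by (subst DERIV_imp_deriv[OF has_field_derivative_Ln]) (auto simp: Ln_slope_def)
qed (auto simp: Ln_slope)

text \<open>\<open>Ln z\<close> vanishes to first order at 1, so the product is a convergent factor
  times \<open>(1 - z) * Ln (1 - z)\<close>.\<close>

lemma tendsto_Ln_mult_Ln: "((\<lambda>z. Ln z * Ln (1 - z)) \<longlongrightarrow> 0) (at 1)"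
proof -
  have "filterlim (\<lambda>z. 1 - z :: complex) (at 0) (at 1)"
    unfolding filterlim_at by (auto intro!: tendsto_eq_intros simp: eventually_at_filter)
  from filterlim_compose[OF tendsto_mult_Ln_0 this]
  have "((\<lambda>z. (1 - z) * Ln (1 - z)) \<longlongrightarrow> 0) (at (1::complex))" .
  moreover have "(Ln_slope \<longlongrightarrow> Ln_slope 1) (at 1)"
    using holomorphic_on_imp_continuous_on[OF holomorphic_Ln_slope]
    by (simp add: continuous_on_eq_continuous_at isCont_def)
  ultimately have "((\<lambda>z. - Ln_slope z * ((1 - z) * Ln (1 - z))) \<longlongrightarrow> - Ln_slope 1 * 0) (at 1)"
    by (intro tendsto_intros)
  moreover have "- Ln_slope z * ((1 - z) * Ln (1 - z)) = Ln z * Ln (1 - z)" for z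
    by (simp flip: Ln_slope[of z]) (simp add: algebra_simps)
  ultimately show ?thesis by simp
qed

lemma slit_plane_ball_nz:
  "z \<in> slit_plane \<inter> ball 1 1 \<Longrightarrow> z \<noteq> 0 \<and> z \<noteq> 1 \<and> z \<notin> \<real>\<^sub>\<le>\<^sub>0 \<and> 1 - z \<notin> \<real>\<^sub>\<le>\<^sub>0"
  using abs_Re_le_cmod[of "1 - z"] by (auto simp: slit_plane_iff dist_norm complex_nonpos_Reals_iff)

lemma polylog_2_deriv:
  assumes "z \<in> slit_plane" "z \<noteq> 0"
  shows "(polylog 2 has_field_derivative - Ln (1 - z) / z) (at z)"
  using has_field_derivative_polylog'[OF assms, of 1] assms(1)
  unfolding polylog_1[OF assms(1)] by (simp add: numeral_2_eq_2)

lemma polylog_3_deriv: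
  assumes "z \<in> slit_plane" "z \<noteq> 0"
  shows "(polylog 3 has_field_derivative polylog 2 z / z) (at z)"
  using has_field_derivative_polylog'[OF assms, of 2] by (simp add: numeral_3_eq_3 numeral_2_eq_2)

text \<open>As in Euler's reflection formula, adding \<open>Ln z * Ln (1 - z)\<close> cancels the
  logarithmic singularity of the derivative and leaves \<open>Ln_slope\<close>, which is holomorphic
  at 1; the added product tends to 0.\<close>

lemma polylog_2_tendsto_1: "\<exists>l. (polylog 2 \<longlongrightarrow> l) (at 1 within slit_plane)"
proof -
  have "((\<lambda>z. polylog 2 z + Ln z * Ln (1 - z)) has_field_derivative Ln_slope z) (at z)"
    if z: "z \<in> slit_plane \<inter> ball 1 1" for z
    using slit_plane_ball_nz[OF z] z
    by (auto intro!: derivative_eq_intros polylog_2_deriv simp: Ln_slope_def divide_simps)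
       (simp add: algebra_simps)?
  from tendsto_1_within_slit_plane[OF holomorphic_Ln_slope this]
  obtain l where "((\<lambda>z. polylog 2 z + Ln z * Ln (1 - z)) \<longlongrightarrow> l) (at 1 within slit_plane)" by blast
  from tendsto_diff[OF this tendsto_within_subset[OF tendsto_Ln_mult_Ln]]
  show ?thesis by auto
qed

text \<open>Integration by parts leaves \<open>(ln z)\<^sup>2 / (1 - z)\<close>, which is regular at 1.\<close>

lemma polylog_3_tendsto_1: "\<exists>l. (polylog 3 \<longlongrightarrow> l) (at 1 within slit_plane)"
proof -
  let ?\<Phi> = "\<lambda>z. polylog 3 z - polylog 2 z * Ln z - Ln z * (Ln z * Ln (1 - z)) / 2"
  have D: "(?\<Phi> has_field_derivative - Ln z * Ln_slope z / 2) (at z)"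
    if z: "z \<in> slit_plane \<inter> ball 1 1" for z
    using slit_plane_ball_nz[OF z] z
    by (auto intro!: derivative_eq_intros polylog_2_deriv polylog_3_deriv
        simp: Ln_slope_def divide_simps) (simp add: algebra_simps)?
  have hol: "(\<lambda>z. - Ln z * Ln_slope z / 2) holomorphic_on ball 1 1"
    by (intro holomorphic_intros holomorphic_Ln_slope) (auto dest: ball_1_nonpos_Reals)
  obtain l where l: "(?\<Phi> \<longlongrightarrow> l) (at 1 within slit_plane)"
    using tendsto_1_within_slit_plane[OF hol D] by blast
  obtain l2 where l2: "(polylog 2 \<longlongrightarrow> l2) (at 1 within slit_plane)"
    using polylog_2_tendsto_1 by blast
  have Ln: "(Ln \<longlongrightarrow> 0) (at 1 within slit_plane)"
    by (rule tendsto_within_subset[of _ _ _ UNIV]) (auto intro!: tendsto_eq_intros)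
  have "((\<lambda>z. ?\<Phi> z + polylog 2 z * Ln z + Ln z * (Ln z * Ln (1 - z)) / 2) \<longlongrightarrow>
      l + l2 * 0 + 0 * 0 / 2) (at 1 within slit_plane)"
    by (intro tendsto_intros l l2 Ln tendsto_within_subset[OF tendsto_Ln_mult_Ln]) auto
  then show ?thesis by (auto simp: algebra_simps)
qed

text \<open>At 1 the value of \<open>polylog\<close> is a \<open>Lim\<close> by definition, so
  continuity there amounts to the existence of the limit; elsewhere it follows from
  differentiability.\<close>

lemma continuous_on_polylog:
  assumes lim: "\<exists>l. (polylog (Suc k) \<longlongrightarrow> l) (at 1 within slit_plane)"
  shows "continuous_on (insert 1 slit_plane) (polylog (Suc k))"
  unfolding continuous_on_def
proof safe
  obtain l where l: "(polylog (Suc k) \<longlongrightarrow> l) (at 1 within slit_plane)" using lim by blast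
  then have "(polylog_continuation (Suc k) \<longlongrightarrow> l) (at 1 within slit_plane)"
    by (rule Lim_transform_eventually)
       (auto simp: eventually_at_filter polylog_slit_plane)
  \<comment> \<open>A limit determines \<open>Lim\<close> only along a nontrivial filter; the reals
    \<open>1 - 1/(n + 1)\<close> show that 1 is a limit point of the cut plane.\<close>
  moreover have "at 1 within slit_plane \<noteq> bot"
  proof -
    have "complex_of_real r \<in> slit_plane - {1}" if "r < 1" for r
      using that by (auto simp: slit_plane_iff complex_eq_iff)
    moreover have "1 - inverse (real (Suc n)) < 1" for n
      by (simp del: of_nat_Suc)
    ultimately have "complex_of_real (1 - inverse (real (Suc n))) \<in> slit_plane - {1}" for n
      by blast
    moreover have "(\<lambda>n. complex_of_real (1 - inverse (real (Suc n)))) \<longlonglongrightarrow> of_real (1 - 0)"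
      by (intro tendsto_intros LIMSEQ_inverse_real_of_nat)
    ultimately have "1 \<in> closure (slit_plane - {1})"
      unfolding closure_sequential
      by (intro exI[of _ "\<lambda>n. complex_of_real (1 - inverse (real (Suc n)))"]) simp
    then show ?thesis by (simp add: at_within_eq_bot_iff)
  qed
  moreover have "1 \<notin> slit_plane" by (simp add: slit_plane_iff)
  ultimately have "polylog (Suc k) 1 = l"
    by (simp add: polylog_def tendsto_Lim)
  then show "(polylog (Suc k) \<longlongrightarrow> polylog (Suc k) 1) (at 1 within insert 1 slit_plane)"
    using l by (simp add: at_within_def insert_Diff_if)
next
  fix z assume "z \<in> slit_plane"
  then have "(polylog (Suc k) \<longlongrightarrow> polylog (Suc k) z) (at z)"
    using DERIV_isCont[OF has_field_derivative_polylog] by (simp add: isCont_def)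
  then show "(polylog (Suc k) \<longlongrightarrow> polylog (Suc k) z) (at z within insert 1 slit_plane)"
    by (rule tendsto_within_subset) auto
qed

lemma continuous_on_polylog_2: "continuous_on (insert 1 slit_plane) (polylog 2)"
  using continuous_on_polylog[of 1] polylog_2_tendsto_1 by (simp add: numeral_2_eq_2)

lemma continuous_on_polylog_3: "continuous_on (insert 1 slit_plane) (polylog 3)"
  using continuous_on_polylog[of 2] polylog_3_tendsto_1 by (simp add: numeral_3_eq_3 numeral_2_eq_2)


section \<open>A five-term relation along rays\<close>

text \<open>The numerator \<open>c * (x - y)\<close> shows that the value is not real, hence off the
  cut, when \<open>c\<close> is nonzero and \<open>x\<close> differs from \<open>y\<close>.\<close>

lemma Im_moebius:
  "Im (of_real c * ((1 + \<i> * of_real x) / (1 + \<i> * of_real y))) = c * (x - y) / (1 + y\<^sup>2)"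
  by (simp add: Im_divide power2_eq_square right_diff_distrib)

lemma one_plus_ii_nonzero: "1 + \<i> * of_real x \<noteq> 0"
  by (simp add: complex_eq_iff)

lemma moebius_in_slit_plane:
  assumes "x \<noteq> y"
  shows "of_real c * ((1 + \<i> * of_real x) / (1 + \<i> * of_real y)) \<in> slit_plane"
proof (cases "c = 0")
  case False
  have "1 + y\<^sup>2 \<noteq> 0" by (metis add_pos_nonneg less_numeral_extra(1) less_numeral_extra(3) zero_le_power2)
  with False show ?thesis
    unfolding slit_plane_iff Im_moebius using assms by simp
qed (simp add: zero_in_slit_plane)

text \<open>For \<open>x = y\<close> the value is \<open>c\<close> itself, and the bound on
  \<open>c\<close> lets it meet the cut only at the endpoint 1.\<close>

lemma moebius_in_insert_slit_plane:
  assumes "\<bar>c\<bar> \<le> 1"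
  shows "of_real c * ((1 + \<i> * of_real x) / (1 + \<i> * of_real y)) \<in> insert 1 slit_plane"
proof (cases "x = y")
  case True
  then show ?thesis
    using assms one_plus_ii_nonzero[of y] by (auto simp: slit_plane_iff complex_eq_iff)
qed (use moebius_in_slit_plane in blast)

lemma imaginary_in_slit_plane: "\<i> * of_real x \<in> slit_plane" "- (\<i> * of_real x) \<in> slit_plane"
  by (auto simp: slit_plane_iff)

text \<open>The argument \<open>q\<close> has logarithmic derivative
  \<open>u / (1 + u * z) - v / (1 + v * z)\<close>. The spare factor \<open>q\<close> is absorbed by
  the undivided identity \<open>q * Li_(k+1)'(q) = Li_k(q)\<close>, so \<open>c = 0\<close> is
  covered.\<close>

lemma has_field_derivative_polylog_moebius:
  fixes c u v z :: complex
  assumes slit: "c * ((1 + u * z) / (1 + v * z)) \<in> slit_plane"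
    and nz: "1 + u * z \<noteq> 0" "1 + v * z \<noteq> 0"
  shows "((\<lambda>z. polylog (Suc k) (c * ((1 + u * z) / (1 + v * z)))) has_field_derivative
      (u / (1 + u * z) - v / (1 + v * z)) * polylog k (c * ((1 + u * z) / (1 + v * z)))) (at z)"
proof -
  define q where "q = c * ((1 + u * z) / (1 + v * z))"
  have "((\<lambda>z. c * ((1 + u * z) / (1 + v * z))) has_field_derivative
      q * (u / (1 + u * z) - v / (1 + v * z))) (at z)"
    unfolding q_def using nz
    by (auto intro!: derivative_eq_intros simp: divide_simps) (simp add: algebra_simps)?
  from DERIV_chain2[OF has_field_derivative_polylog[OF slit] this]
  show ?thesis
    by (rule DERIV_cong)
       (simp only: deriv_polylog_continuation[OF slit, symmetric] q_def mult_ac)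
qed

lemma has_field_derivative_polylog_cmult:
  fixes u z :: complex
  assumes slit: "u * z \<in> slit_plane" and nz: "z \<noteq> 0"
  shows "((\<lambda>z. polylog (Suc k) (u * z)) has_field_derivative polylog k (u * z) / z) (at z)"
proof -
  have "((\<lambda>z. u * z) has_field_derivative u) (at z)"
    by (auto intro!: derivative_eq_intros)
  from DERIV_chain2[OF has_field_derivative_polylog[OF slit] this]
  show ?thesis
    by (rule DERIV_cong) (use nz in \<open>simp add: deriv_polylog_continuation[OF slit, symmetric]\<close>)
qed

text \<open>Differentiability is asked only inside the interval: at \<open>t = 0\<close> the
  functions to come are merely shown continuous, because of factors \<open>Ln (s * t)\<close> and of
  the branch point 1.\<close>

lemma has_integral_unit_interval_complex:
  fixes f :: "complex \<Rightarrow> complex"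
  assumes "continuous_on {0..1} (\<lambda>t. f (of_real t))"
    and "\<And>t. 0 < t \<Longrightarrow> t < 1 \<Longrightarrow> (f has_field_derivative f' t) (at (of_real t))"
  shows "(f' has_integral f 1 - f 0) {0..1}"
proof -
  have "(f' has_integral f (of_real 1) - f (of_real 0)) {0..1}"
    using assms by (intro fundamental_theorem_of_calculus_interior has_vector_derivative_real_field) auto
  then show ?thesis by simp
qed

text \<open>\<open>Ln (1 + u * z)\<close> vanishes at least to first order at 0, which outweighs the
  logarithmic growth of \<open>Ln (s * z)\<close>.\<close>

lemma tendsto_Ln_cmult_mult_Ln:
  assumes "s \<noteq> 0"
  shows "((\<lambda>z. Ln (s * z) * Ln (1 + u * z)) \<longlongrightarrow> 0) (at 0)"
proof -
  have "filterlim (\<lambda>z. s * z) (at 0) (at (0::complex))"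
    using assms unfolding filterlim_at by (auto intro!: tendsto_eq_intros simp: eventually_at_filter)
  from filterlim_compose[OF tendsto_mult_Ln_0 this]
  have "((\<lambda>z. s * z * Ln (s * z)) \<longlongrightarrow> 0) (at 0)" .
  moreover have "((\<lambda>z. Ln_slope (1 + u * z)) \<longlongrightarrow> Ln_slope 1) (at 0)"
  proof (rule isCont_tendsto_compose[where g = Ln_slope])
    show "isCont Ln_slope 1"
      using holomorphic_on_imp_continuous_on[OF holomorphic_Ln_slope]
      by (simp add: continuous_on_eq_continuous_at)
  qed (auto intro!: tendsto_eq_intros)
  ultimately have "((\<lambda>z. u / s * (s * z * Ln (s * z)) * Ln_slope (1 + u * z)) \<longlongrightarrow>
      u / s * 0 * Ln_slope 1) (at 0)"
    by (intro tendsto_intros)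
  moreover have "u / s * (s * z * Ln (s * z)) * Ln_slope (1 + u * z) = Ln (s * z) * Ln (1 + u * z)" for z
    using Ln_slope[of "1 + u * z"] assms by (simp add: mult_ac flip: Ln_slope[of "1 + u * z"])
  ultimately show ?thesis by simp
qed

lemma one_plus_ii_nonpos_Reals: "1 + \<i> * of_real x \<notin> \<real>\<^sub>\<le>\<^sub>0"
  by (simp add: complex_nonpos_Reals_iff)

lemma continuous_on_Ln_cmult_mult_Ln:
  assumes "s \<notin> \<real>\<^sub>\<le>\<^sub>0"
  shows "continuous_on {0..1}
    (\<lambda>t::real. Ln (s * of_real t) * Ln (1 + \<i> * of_real x * of_real t))"
  unfolding continuous_on_def
proof
  have s: "s \<noteq> 0" using assms by auto
  fix t :: real assume t: "t \<in> {0..1}"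
  let ?f = "\<lambda>z. Ln (s * z) * Ln (1 + \<i> * of_real x * z)"
  have "(?f \<longlongrightarrow> ?f (of_real t)) (at (of_real t))"
  \<comment> \<open>At \<open>t = 0\<close> the product is 0 because \<open>Ln 1 = 0\<close>,
    whatever the value of \<open>Ln 0\<close>, and this agrees with the limit.\<close>
  proof (cases "t = 0")
    case True
    then show ?thesis using tendsto_Ln_cmult_mult_Ln[of s "\<i> * of_real x"] s by simp
  next
    case False
    then have "s * of_real t \<notin> \<real>\<^sub>\<le>\<^sub>0"
      using assms t by (auto simp: complex_nonpos_Reals_iff mult_le_0_iff)
    moreover have "1 + \<i> * of_real x * of_real t \<notin> \<real>\<^sub>\<le>\<^sub>0"
      by (simp add: complex_nonpos_Reals_iff)
    ultimately show ?thesis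
      by (intro tendsto_intros) auto
  qed
  then have "isCont ?f (of_real t)" by (simp add: isCont_def)
  then have "isCont (\<lambda>t. ?f (of_real t)) t"
    by (rule isCont_o2[rotated]) (intro continuous_intros)
  then show "((\<lambda>t. ?f (of_real t)) \<longlongrightarrow> ?f (of_real t)) (at t within {0..1})"
    unfolding isCont_def by (rule tendsto_within_subset) simp
qed

section \<open>Branches of the logarithms and the dilogarithm relation\<close>

text \<open>Both logarithms have imaginary part at most \<open>pi / 2\<close> in absolute value, one
  of them strictly less, so their difference stays in the principal strip.\<close>

lemma Ln_divide_one_plus_ii:
  assumes "w \<noteq> 0" "Re w \<ge> 0"
  shows "Ln (w / (1 + \<i> * of_real y)) = Ln w - Ln (1 + \<i> * of_real y)"
proof (rule Ln_unique)
  show "exp (Ln w - Ln (1 + \<i> * of_real y)) = w / (1 + \<i> * of_real y)"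
    using assms one_plus_ii_nonzero by (simp add: exp_diff)
  have "\<bar>Im (Ln (1 + \<i> * of_real y))\<bar> < pi / 2"
    by (rule Re_Ln_pos_lt_imp) simp
  moreover have "\<bar>Im (Ln w)\<bar> \<le> pi / 2" using Re_Ln_pos_le assms by blast
  ultimately show "- pi < Im (Ln w - Ln (1 + \<i> * of_real y))"
    "Im (Ln w - Ln (1 + \<i> * of_real y)) \<le> pi" by auto
qed

text \<open>With \<open>a = 1 + ix\<close> and \<open>b = 1 + iy\<close> one has \<open>1 - a/b = (1 - y/x) (-ix) / b\<close> and
  \<open>1 - (y/x) a/b = (1 - y/x) / b\<close>.\<close>

lemma Ln_moebius_diff:
  fixes x y :: real
  assumes "x \<noteq> 0" "\<bar>y\<bar> \<le> \<bar>x\<bar>" "y \<noteq> x"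
  shows "Ln (1 - (1 + \<i> * x) / (1 + \<i> * y)) - Ln (1 - of_real (y / x) * ((1 + \<i> * x) / (1 + \<i> * y)))
    = Ln (- (\<i> * x))"
proof -
  define d where "d = 1 - y / x"
  \<comment> \<open>Here the bound on \<open>y / x\<close> enters: for positive \<open>d\<close> the
    term \<open>ln d\<close> splits off both logarithms without branch correction and
    cancels.\<close>
  have "d > 0" using assms by (auto simp: d_def divide_simps abs_if split: if_splits)
  have nz: "1 + \<i> * of_real y \<noteq> 0" by (rule one_plus_ii_nonzero)
  have "1 - (1 + \<i> * x) / (1 + \<i> * y) = of_real d * (- (\<i> * x)) / (1 + \<i> * y)"
    using nz assms(1) by (simp add: d_def divide_simps) (simp add: algebra_simps)
  moreover have "1 - of_real (y / x) * ((1 + \<i> * x) / (1 + \<i> * y)) = of_real d / (1 + \<i> * y)"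
    using nz assms(1) by (simp add: d_def divide_simps) (simp add: algebra_simps)
  moreover have "Ln (of_real d * (- (\<i> * x))) = of_real (ln d) + Ln (- (\<i> * x))"
    using \<open>d > 0\<close> assms(1) by (subst Ln_times_of_real) (auto simp: Ln_of_real)
  moreover have "Ln (of_real d * (- (\<i> * x)) / (1 + \<i> * y))
      = Ln (of_real d * (- (\<i> * x))) - Ln (1 + \<i> * y)"
    using \<open>d > 0\<close> assms(1) by (intro Ln_divide_one_plus_ii) auto
  moreover have "Ln (of_real d / (1 + \<i> * y)) = Ln (of_real d) - Ln (1 + \<i> * y)"
    using \<open>d > 0\<close> by (intro Ln_divide_one_plus_ii) auto
  moreover have "Ln (of_real d) = of_real (ln d)" using \<open>d > 0\<close> by (rule Ln_of_real)
  ultimately show ?thesis by simp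
qed

text \<open>Scaling \<open>(x, y)\<close> to \<open>(x * t, y * t)\<close> keeps
  \<open>y / x\<close> fixed, so the relation is the equality of \<open>E\<close> at 0 and 1; the
  logarithms in the derivative of \<open>E\<close> cancel by \<open>Ln_moebius_diff\<close>.\<close>

lemma polylog_2_five_term:
  fixes x y :: real
  assumes x: "x \<noteq> 0" and le: "\<bar>y\<bar> \<le> \<bar>x\<bar>"
  shows "polylog 2 ((1 + \<i> * x) / (1 + \<i> * y)) - polylog 2 (of_real (y / x) * ((1 + \<i> * x) / (1 + \<i> * y)))
    = polylog 2 1 - polylog 2 (of_real (y / x)) - Ln (- (\<i> * x)) * (Ln (1 + \<i> * x) - Ln (1 + \<i> * y))
      - polylog 2 (- (\<i> * x)) + polylog 2 (- (\<i> * y))"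
proof (cases "y = x")
  case True
  then show ?thesis using x one_plus_ii_nonzero[of x] by simp
next
  case False
  define u v :: complex where "u = \<i> * x" and "v = \<i> * y"
  define c where "c = y / x"
  have c: "\<bar>c\<bar> \<le> 1" using x le by (simp add: c_def)
  \<comment> \<open>The explicit factor 1 gives both Moebius dilogarithms the shape
    \<open>of_real b * ...\<close>, so that one fact serves \<open>b = 1\<close> and
    \<open>b = c\<close>.\<close>
  define E where "E = (\<lambda>z. polylog 2 (1 * ((1 + u * z) / (1 + v * z)))
      - polylog 2 (of_real c * ((1 + u * z) / (1 + v * z)))
      + (Ln (- u * z) * Ln (1 + u * z) - Ln (- u * z) * Ln (1 + v * z))
      + polylog 2 (- u * z) - polylog 2 (- v * z))"
  have "((\<lambda>_. 0) has_integral (E 1 - E 0)) {0..1::real}"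
  proof (rule has_integral_unit_interval_complex)
    have mu: "- u * of_real t = - (\<i> * of_real (x * t))" "- v * of_real t = - (\<i> * of_real (y * t))"
      and pu: "u * of_real t = \<i> * of_real (x * t)" "v * of_real t = \<i> * of_real (y * t)" for t
      by (simp_all add: u_def v_def)
    have M: "of_real b * ((1 + u * of_real t) / (1 + v * of_real t)) \<in> insert 1 slit_plane"
      if "\<bar>b\<bar> \<le> 1" for b t :: real
      unfolding pu using that by (rule moebius_in_insert_slit_plane)
    have nz: "1 + u * of_real t \<noteq> 0" "1 + v * of_real t \<noteq> 0" for t :: real
      unfolding pu by (rule one_plus_ii_nonzero)+
    have Lc: "continuous_on {0..1} (\<lambda>t::real. Ln (- u * t) * Ln (1 + u * t))"
      "continuous_on {0..1} (\<lambda>t::real. Ln (- u * t) * Ln (1 + v * t))"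
      unfolding u_def v_def
      by (rule continuous_on_Ln_cmult_mult_Ln, use x in \<open>simp add: complex_nonpos_Reals_iff\<close>)+
    have Mc: "continuous_on {0..1} (\<lambda>t::real. of_real b * ((1 + u * of_real t) / (1 + v * of_real t)))" for b
      by (intro continuous_intros ballI nz)
    have Pc: "continuous_on {0..1} (\<lambda>t. polylog 2 (of_real b * ((1 + u * of_real t) / (1 + v * of_real t))))"
      if "\<bar>b\<bar> \<le> 1" for b
      by (rule continuous_on_compose2[OF continuous_on_polylog_2 Mc]) (use M that in blast)
    have sm: "- u * of_real t \<in> insert 1 slit_plane" "- v * of_real t \<in> insert 1 slit_plane"
      for t :: real
      unfolding mu using imaginary_in_slit_plane by blast+
    have lin: "continuous_on {0..1} (\<lambda>t::real. s * of_real t)" for s :: complex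
      by (intro continuous_intros)
    have Ic: "continuous_on {0..1} (\<lambda>t::real. polylog 2 (- u * t))"
       "continuous_on {0..1} (\<lambda>t::real. polylog 2 (- v * t))"
      by (rule continuous_on_compose2[OF continuous_on_polylog_2 lin], use sm in blast)+
    show "continuous_on {0..1} (\<lambda>t. E (of_real t))"
      unfolding E_def
      by (intro continuous_on_add continuous_on_diff Lc Ic Pc[of 1, unfolded of_real_1] Pc c) simp
  next
    fix t :: real assume t: "0 < t" "t < 1"
    have mu: "- u * of_real t = - (\<i> * of_real (x * t))" "- v * of_real t = - (\<i> * of_real (y * t))"
      and pu: "u * of_real t = \<i> * of_real (x * t)" "v * of_real t = \<i> * of_real (y * t)"
      by (simp_all add: u_def v_def)
    have xt: "x * t \<noteq> y * t" using False t by simp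
    have slit: "of_real b * ((1 + u * of_real t) / (1 + v * of_real t)) \<in> slit_plane" for b :: real
      unfolding pu using xt by (rule moebius_in_slit_plane)
    have nz: "1 + u * of_real t \<noteq> 0" "1 + v * of_real t \<noteq> 0"
      unfolding pu by (rule one_plus_ii_nonzero)+
    have nr: "1 + u * of_real t \<notin> \<real>\<^sub>\<le>\<^sub>0" "1 + v * of_real t \<notin> \<real>\<^sub>\<le>\<^sub>0"
      unfolding pu by (rule one_plus_ii_nonpos_Reals)+
    have nm: "- u * of_real t \<notin> \<real>\<^sub>\<le>\<^sub>0"
      using x t by (simp add: u_def complex_nonpos_Reals_iff)
    have sm: "- u * of_real t \<in> slit_plane" "- v * of_real t \<in> slit_plane"
      unfolding mu by (rule imaginary_in_slit_plane)+
    have two: "2 = Suc 1" by simp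
    have D1: "((\<lambda>z. polylog 2 (of_real b * ((1 + u * z) / (1 + v * z)))) has_field_derivative
      (u / (1 + u * t) - v / (1 + v * t)) * - Ln (1 - of_real b * ((1 + u * t) / (1 + v * t)))) (at t)"
      for b :: real
      using has_field_derivative_polylog_moebius[OF slit nz, of 1]
      unfolding polylog_1[OF slit] by (simp only: two)
    have D2: "((\<lambda>z. polylog 2 (- u * z)) has_field_derivative - Ln (1 + u * t) / t) (at t)"
      using has_field_derivative_polylog_cmult[OF sm(1), of 1] t
      unfolding polylog_1[OF sm(1)] by (simp add: numeral_2_eq_2)
    have D3: "((\<lambda>z. polylog 2 (- v * z)) has_field_derivative - Ln (1 + v * t) / t) (at t)"
      using has_field_derivative_polylog_cmult[OF sm(2), of 1] t
      unfolding polylog_1[OF sm(2)] by (simp add: numeral_2_eq_2)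
    have D4: "((\<lambda>z. Ln (1 + u * z)) has_field_derivative u / (1 + u * t)) (at t)"
      "((\<lambda>z. Ln (1 + v * z)) has_field_derivative v / (1 + v * t)) (at t)"
      using nr nz by (auto intro!: derivative_eq_intros simp: divide_simps)
    have D5: "((\<lambda>z. Ln (- u * z)) has_field_derivative 1 / t) (at t)"
      using nm t x by (auto intro!: derivative_eq_intros simp: divide_simps u_def)
    have diff: "Ln (1 - 1 * ((1 + u * t) / (1 + v * t)))
        - Ln (1 - of_real c * ((1 + u * t) / (1 + v * t))) = Ln (- u * t)"
      using Ln_moebius_diff[of "x * t" "y * t"] x le False t
      unfolding mu pu by (simp add: c_def abs_mult mult_right_mono)
    let ?m = "u / (1 + u * t) - v / (1 + v * t)"
    have "(E has_field_derivative
        ?m * - Ln (1 - 1 * ((1 + u * t) / (1 + v * t)))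
        - ?m * - Ln (1 - of_real c * ((1 + u * t) / (1 + v * t)))
        + ((1 / t * Ln (1 + u * t) + u / (1 + u * t) * Ln (- u * t))
          - (1 / t * Ln (1 + v * t) + v / (1 + v * t) * Ln (- u * t)))
        + - Ln (1 + u * t) / t - - Ln (1 + v * t) / t) (at t)"
      unfolding E_def
      by (intro DERIV_add DERIV_diff DERIV_mult D1[of 1, unfolded of_real_1] D1[of c] D2 D3 D4 D5)
    \<comment> \<open>The terms in \<open>1 / t\<close> cancel against the derivatives of the
      dilogarithms at \<open>- u * z\<close> and \<open>- v * z\<close>; the others cancel by the
      logarithm identity \<open>M - L = N\<close>.\<close>
    moreover have "m * - M - m * - L + ((1 / t * A + p * N) - (1 / t * B + q * N)) + - A / t - - B / t = 0"
      if "M - L = N" "m = p - q" for m M L A B N p q :: complex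
      unfolding that(1)[symmetric] that(2) by (simp add: algebra_simps)
    ultimately show "(E has_field_derivative 0) (at t)"
      using DERIV_cong diff by blast
  qed
  then have "E 1 = E 0" using has_integral_unique[OF _ has_integral_0] by fastforce
  moreover have "E 0 = polylog 2 1 - polylog 2 (of_real c)"
    by (simp add: E_def)
  moreover have "E 1 = polylog 2 ((1 + u) / (1 + v)) - polylog 2 (of_real c * ((1 + u) / (1 + v)))
      + Ln (- u) * (Ln (1 + u) - Ln (1 + v)) + polylog 2 (- u) - polylog 2 (- v)"
    by (simp add: E_def right_diff_distrib)
  moreover have "a - b = z - r - l - p + q"
    if "e1 = e0" "e0 = z - r" "e1 = a - b + l + p - q" for e1 e0 a b z r l p q :: complex
  proof -
    have "a - b + l + p - q = z - r" using that by simp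
    then show ?thesis by (simp add: algebra_simps)
  qed
  ultimately show ?thesis
    unfolding u_def v_def c_def by blast
qed

section \<open>The trilogarithmic primitive\<close>

text \<open>The two trilogarithms are paired because their derivatives share a factor and together
  produce the dilogarithm difference evaluated by \<open>polylog_2_five_term\<close>.\<close>

definition Li3_diff :: "real \<Rightarrow> real \<Rightarrow> complex \<Rightarrow> complex" where
  "Li3_diff x y z = polylog 3 (of_real 1 * ((1 + \<i> * of_real x * z) / (1 + \<i> * of_real y * z)))
     - polylog 3 (of_real (y / x) * ((1 + \<i> * of_real x * z) / (1 + \<i> * of_real y * z)))"

lemma Li3_diff_0: "Li3_diff x y 0 = polylog 3 1 - polylog 3 (of_real (y / x))"
  by (simp add: Li3_diff_def)

lemma continuous_on_Li3_diff:
  assumes "x \<noteq> 0" "\<bar>y\<bar> \<le> \<bar>x\<bar>"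
  shows "continuous_on {0..1::real} (\<lambda>t. Li3_diff x y (of_real t))"
proof -
  have pu: "\<i> * of_real a * of_real t = \<i> * of_real (a * t)" for a t :: real by simp
  have M: "continuous_on {0..1::real} (\<lambda>t. polylog 3
      (of_real b * ((1 + \<i> * of_real x * of_real t) / (1 + \<i> * of_real y * of_real t))))"
    if "\<bar>b\<bar> \<le> 1" for b
  proof (rule continuous_on_compose2[OF continuous_on_polylog_3])
    show "continuous_on {0..1::real} (\<lambda>t.
        of_real b * ((1 + \<i> * of_real x * of_real t) / (1 + \<i> * of_real y * of_real t)))"
      by (intro continuous_intros ballI) (use one_plus_ii_nonzero pu in metis)
  qed (use moebius_in_insert_slit_plane[OF that] in \<open>simp only: pu image_subset_iff, blast\<close>)
  show ?thesis
    unfolding Li3_diff_def using assms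
    by (intro continuous_on_diff M) auto
qed

text \<open>The five-term relation at \<open>(x * t, y * t)\<close> replaces the dilogarithms of
  Moebius argument by ones of constant or purely imaginary argument. For \<open>y = x\<close> both
  sides are 0.\<close>

lemma has_field_derivative_Li3_diff:
  fixes x y t :: real
  assumes x: "x \<noteq> 0" and le: "\<bar>y\<bar> \<le> \<bar>x\<bar>" and t: "t > 0"
  shows "(Li3_diff x y has_field_derivative
      (\<i> * x / (1 + \<i> * x * t) - \<i> * y / (1 + \<i> * y * t)) *
      (polylog 2 1 - polylog 2 (of_real (y / x))
        - Ln (- (\<i> * x * t)) * (Ln (1 + \<i> * x * t) - Ln (1 + \<i> * y * t))
        - polylog 2 (- (\<i> * x * t)) + polylog 2 (- (\<i> * y * t)))) (at t)"
proof (cases "y = x")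
  case True
  then have "Li3_diff x y = (\<lambda>_. 0)" using x by (auto simp: Li3_diff_def)
  then show ?thesis using True by simp
next
  case False
  have pu: "\<i> * of_real a * of_real t = \<i> * of_real (a * t)" for a :: real by simp
  have xt: "x * t \<noteq> y * t" using False t by simp
  have slit: "of_real b * ((1 + \<i> * x * t) / (1 + \<i> * y * t)) \<in> slit_plane" for b :: real
    unfolding pu using xt by (rule moebius_in_slit_plane)
  have nz: "1 + \<i> * x * t \<noteq> 0" "1 + \<i> * y * t \<noteq> 0"
    unfolding pu by (rule one_plus_ii_nonzero)+
  have three: "3 = Suc 2" by simp
  define m where "m = \<i> * x / (1 + \<i> * x * t) - \<i> * y / (1 + \<i> * y * t)"
  have D: "((\<lambda>z. polylog 3 (of_real b * ((1 + \<i> * x * z) / (1 + \<i> * y * z)))) has_field_derivative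
      m * polylog 2 (of_real b * ((1 + \<i> * x * t) / (1 + \<i> * y * t)))) (at t)" for b :: real
    unfolding three m_def by (rule has_field_derivative_polylog_moebius[OF slit nz])
  have "(Li3_diff x y has_field_derivative
      m * (polylog 2 (of_real 1 * ((1 + \<i> * x * t) / (1 + \<i> * y * t)))
         - polylog 2 (of_real (y / x) * ((1 + \<i> * x * t) / (1 + \<i> * y * t))))) (at t)"
    unfolding Li3_diff_def[abs_def] right_diff_distrib by (intro DERIV_diff D)
  moreover have "polylog 2 (of_real 1 * ((1 + \<i> * x * t) / (1 + \<i> * y * t)))
         - polylog 2 (of_real (y / x) * ((1 + \<i> * x * t) / (1 + \<i> * y * t)))
     = polylog 2 1 - polylog 2 (of_real (y / x))
        - Ln (- (\<i> * x * t)) * (Ln (1 + \<i> * x * t) - Ln (1 + \<i> * y * t))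
        - polylog 2 (- (\<i> * x * t)) + polylog 2 (- (\<i> * y * t))"
    using polylog_2_five_term[of "x * t" "y * t"] x le t
    unfolding pu by (simp add: abs_mult mult_right_mono)
  ultimately show ?thesis unfolding m_def by metis
qed

section \<open>From complex logarithms to \<open>arctan\<close> and real \<open>ln\<close>\<close>

lemma Ln_one_plus_ii:
  "Ln (1 + \<i> * of_real x) = of_real (ln (1 + x\<^sup>2) / 2) + \<i> * of_real (arctan x)"
proof (rule complex_eqI)
  have "1 + x\<^sup>2 > 0" by (intro add_pos_nonneg) auto
  moreover have "norm (1 + \<i> * of_real x) = sqrt (1 + x\<^sup>2)"
    by (simp add: cmod_def)
  ultimately show "Re (Ln (1 + \<i> * of_real x)) = Re (of_real (ln (1 + x\<^sup>2) / 2) + \<i> * of_real (arctan x))"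
    using one_plus_ii_nonzero[of x] by (simp add: ln_sqrt)
  show "Im (Ln (1 + \<i> * of_real x)) = Im (of_real (ln (1 + x\<^sup>2) / 2) + \<i> * of_real (arctan x))"
    using arg_conv_arctan[of "1 + \<i> * of_real x"] one_plus_ii_nonzero[of x]
    by (simp add: Arg_eq_Im_Ln)
qed

text \<open>The two signs of \<open>pi / 2\<close> are the origin of the term with \<open>pi\<close>
  in the final formula.\<close>

lemma Ln_ii_times_of_real:
  assumes "r > 0"
  shows "Ln (\<i> * of_real r) = of_real (ln r) + \<i> * pi / 2"
    and "Ln (- (\<i> * of_real r)) = of_real (ln r) - \<i> * pi / 2"
  using Ln_times_of_real[OF assms, of \<i>] Ln_times_of_real[OF assms, of "- \<i>"] assms
  by (simp_all add: mult.commute Ln_of_real)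

text \<open>\<open>F\<close> is the right-hand side of the formula at \<open>(v * z, w * z)\<close>,
  with \<open>A\<close> and \<open>P\<close> in place of the real functions. The last product is
  expanded so that each \<open>Ln (of_real v * z) * A x z\<close> is continuous at 0 by
  \<open>continuous_on_Ln_cmult_mult_Ln\<close>.\<close>

lemma trilog_primitive:
  fixes v w :: real
  assumes v: "v > 0" and le: "\<bar>w\<bar> \<le> v"
  defines "A \<equiv> \<lambda>x z. Ln (1 + \<i> * of_real x * z)"
    and "P \<equiv> \<lambda>x z. polylog 2 (\<i> * of_real x * z)"
  defines "L \<equiv> \<lambda>z. A v z + A (- v) z - A w z - A (- w) z"
    and "h \<equiv> \<i> * of_real pi / 2"
  defines "F \<equiv> \<lambda>z. 2 * polylog 3 (of_real (w / v)) - 2 * polylog 3 (of_real (- (w / v)))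
      + Li3_diff v w z + Li3_diff (- v) (- w) z - Li3_diff v (- w) z - Li3_diff (- v) w z
      + L z * (polylog 2 (of_real (w / v)) - polylog 2 (of_real (- (w / v))))
      + (A v z - A (- v) z) * (P w z - P (- w) z)
      + (A w z - A (- w) z) * (P v z - P (- v) z)
      + h * (L z * (A w z - A (- w) z))
      - (Ln (of_real v * z) * A v z - Ln (of_real v * z) * A (- v) z) * (A w z - A (- w) z)"
  shows "((\<lambda>t. of_real (- 4 * (arctan (v * t) * arctan (w * t) / t))) has_integral F 1) {0..1}"
proof -
  define f' where "f' = (\<lambda>t::real. (A v t - A (- v) t) * (A w t - A (- w) t) / t)"
  have pu: "\<i> * of_real x * of_real t = \<i> * of_real (x * t)" for x t :: real by simp
  have nr: "1 + \<i> * of_real x * of_real t \<notin> \<real>\<^sub>\<le>\<^sub>0" for x t :: real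
    unfolding pu by (rule one_plus_ii_nonpos_Reals)
  have nz: "1 + \<i> * of_real x * of_real t \<noteq> 0" for x t :: real
    unfolding pu by (rule one_plus_ii_nonzero)
  have slit: "\<i> * of_real x * of_real t \<in> slit_plane" for x t :: real
    unfolding pu by (rule imaginary_in_slit_plane)
  have "(f' has_integral F 1 - F 0) {0..1}"
  proof (rule has_integral_unit_interval_complex)
    have Ac: "continuous_on {0..1} (\<lambda>t::real. A x t)" for x
      unfolding A_def by (intro continuous_intros nr)
    have Pc: "continuous_on {0..1} (\<lambda>t::real. P x t)" for x
      unfolding P_def
      by (rule continuous_on_compose2[OF continuous_on_polylog_2])
         (use slit in \<open>auto intro!: continuous_intros\<close>)
    have lc: "continuous_on {0..1} (\<lambda>t::real. Ln (of_real v * t) * A x t)" for x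
      unfolding A_def using v by (intro continuous_on_Ln_cmult_mult_Ln) auto
    show "continuous_on {0..1} (\<lambda>t::real. F t)"
      unfolding F_def L_def using v le
      by (intro continuous_on_add continuous_on_diff continuous_on_mult continuous_on_const Ac Pc lc
          continuous_on_Li3_diff) auto
  next
    fix t :: real assume t: "0 < t" "t < 1"
    define d where "d = (\<lambda>x. \<i> * of_real x / (1 + \<i> * of_real x * of_real t))"
    define R where "R = polylog 2 (of_real (w / v))"
    define R' where "R' = polylog 2 (of_real (- (w / v)))"
    define \<zeta> where "\<zeta> = polylog 2 1"
    have dA: "(A x has_field_derivative d x) (at t)" for x
      unfolding A_def d_def using nr[of x t] by (auto intro!: derivative_eq_intros simp: divide_inverse mult.commute)
    \<comment> \<open>The derivative of the dilogarithm at \<open>\<i> * x * t\<close> involves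
      \<open>Ln (1 - \<i> * x * t)\<close>, which is \<open>A\<close> at \<open>- x\<close>.\<close>
    have dP: "(P x has_field_derivative - A (- x) t / t) (at t)" for x
      using has_field_derivative_polylog_cmult[OF slit[of x t], of 1] t
      unfolding polylog_1[OF slit] by (simp add: numeral_2_eq_2 P_def A_def)
    have dl: "((\<lambda>z. Ln (of_real v * z)) has_field_derivative 1 / of_real t) (at t)"
      using v t by (auto intro!: derivative_eq_intros simp: complex_nonpos_Reals_iff divide_simps mult_le_0_iff)
    \<comment> \<open>\<open>- (\<i> * x * t)\<close> lies on the negative imaginary axis for
      \<open>x = v\<close> and on the positive one for \<open>x = - v\<close>, hence the opposite
      signs of \<open>h\<close>.\<close>
    have lnv: "Ln (- (\<i> * of_real v * t)) = Ln (of_real v * of_real t) - h"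
      "Ln (- (\<i> * of_real (- v) * t)) = Ln (of_real v * of_real t) + h"
      using Ln_ii_times_of_real[of "v * t"] Ln_of_real[of "v * t"] v t
      by (simp_all add: h_def mult.assoc)
    have dLi: "(Li3_diff x y has_field_derivative
      (d x - d y) * (\<zeta> - r - l * (A x t - A y t) - P (- x) t + P (- y) t)) (at t)"
      if "x \<noteq> 0" "\<bar>y\<bar> \<le> \<bar>x\<bar>" "r = polylog 2 (of_real (y / x))" "l = Ln (- (\<i> * x * t))" for x y r l
      using has_field_derivative_Li3_diff[OF that(1,2) t(1)] that(3,4)
      by (simp add: d_def A_def P_def \<zeta>_def)
    let ?l = "Ln (of_real v * of_real t)"
    \<comment> \<open>The derivative keeps the shape produced by the rules, double negations
      included, so that it can be matched summand by summand.\<close>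
    have "(F has_field_derivative
        0 - 0
        + (d v - d w) * (\<zeta> - R - (?l - h) * (A v t - A w t) - P (- v) t + P (- w) t)
        + (d (- v) - d (- w)) * (\<zeta> - R - (?l + h) * (A (- v) t - A (- w) t) - P (- (- v)) t + P (- (- w)) t)
        - (d v - d (- w)) * (\<zeta> - R' - (?l - h) * (A v t - A (- w) t) - P (- v) t + P (- (- w)) t)
        - (d (- v) - d w) * (\<zeta> - R' - (?l + h) * (A (- v) t - A w t) - P (- (- v)) t + P (- w) t)
        + (d v + d (- v) - d w - d (- w)) * (R - R')
        + ((d v - d (- v)) * (P w t - P (- w) t)
           + (- A (- w) t / t - - A (- (- w)) t / t) * (A v t - A (- v) t))
        + ((d w - d (- w)) * (P v t - P (- v) t)
           + (- A (- v) t / t - - A (- (- v)) t / t) * (A w t - A (- w) t))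
        + h * ((d v + d (- v) - d w - d (- w)) * (A w t - A (- w) t)
           + (d w - d (- w)) * L t)
        - (((1 / of_real t * A v t + d v * ?l) - (1 / of_real t * A (- v) t + d (- v) * ?l)) * (A w t - A (- w) t)
           + (d w - d (- w)) * (?l * A v t - ?l * A (- v) t))) (at t)"
      unfolding F_def L_def R_def[symmetric] R'_def[symmetric]
      by (intro DERIV_add DERIV_diff DERIV_mult DERIV_cmult DERIV_cmult_right DERIV_const dA dP dl dLi)
         (use v le lnv in \<open>auto simp: R_def R'_def\<close>)
    \<comment> \<open>The coefficients of \<open>\<zeta>\<close> sum to 0 by the choice of signs of
      the four \<open>Li3_diff\<close> terms, those of \<open>R\<close> and \<open>R'\<close> cancel
      against the derivative of \<open>L\<close>, and what survives is \<open>f'\<close>.\<close>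
    then show "(F has_field_derivative f' t) (at t)"
      by (rule DERIV_cong) (simp add: f'_def L_def divide_inverse, algebra)
  qed
  \<comment> \<open>At 0 each \<open>Li3_diff\<close> is \<open>polylog 3 1\<close> minus
    \<open>polylog 3\<close> at plus or minus \<open>w / v\<close>; the former cancel by signs, the
    latter against the constant trilogarithms in \<open>F\<close>.\<close>
  moreover have "F 0 = 0"
    by (simp add: F_def L_def A_def P_def Li3_diff_0)
  moreover have "f' = (\<lambda>t. of_real (- 4 * (arctan (v * t) * arctan (w * t) / t)))"
    unfolding f'_def A_def pu Ln_one_plus_ii by (rule ext) (simp add: algebra_simps arctan_minus)
  ultimately show ?thesis by simp
qed

section \<open>Evaluation of the primitive at 1\<close>

theorem theorem7p1:
  fixes v w :: real
  assumes v_pos: "v > 0"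
    and ratio: "\<bar>w / v\<bar> \<le> 1"
  shows "complex_of_real (- 4 * T_fun v w) =
      2 * polylog 3 (w / v) - 2 * polylog 3 (- (w / v))
    + polylog 3 ((1 - v * \<i>) / (1 - w * \<i>)) + polylog 3 ((1 + v * \<i>) / (1 + w * \<i>))
    - polylog 3 ((1 + v * \<i>) / (1 - w * \<i>)) - polylog 3 ((1 - v * \<i>) / (1 + w * \<i>))
    - polylog 3 ((w * (1 - v * \<i>)) / (v * (1 - w * \<i>)))
    - polylog 3 ((w * (1 + v * \<i>)) / (v * (1 + w * \<i>)))
    + polylog 3 (- ((w * (1 + v * \<i>)) / (v * (1 - w * \<i>))))
    + polylog 3 (- ((w * (1 - v * \<i>)) / (v * (1 + w * \<i>))))
    + ln ((1 + v\<^sup>2) / (1 + w\<^sup>2)) * (polylog 2 (w / v) - polylog 2 (- (w / v)))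
    - 4 * arctan v * ((polylog 2 (w * \<i>) - polylog 2 (- (w * \<i>))) / (2 * \<i>))
    - 4 * arctan w * ((polylog 2 (v * \<i>) - polylog 2 (- (v * \<i>))) / (2 * \<i>))
    - pi * ln ((1 + v\<^sup>2) / (1 + w\<^sup>2)) * arctan w
    + 4 * ln v * arctan v * arctan w"
proof -
  have v: "v > 0" and le: "\<bar>w\<bar> \<le> v"
    using v_pos ratio by (simp_all add: divide_le_eq)
  let ?A = "\<lambda>x. Ln (1 + \<i> * of_real x)" and ?P = "\<lambda>x. polylog 2 (\<i> * of_real x)"
  let ?L = "?A v + ?A (- v) - ?A w - ?A (- w)"
  let ?D = "\<lambda>x y. polylog 3 ((1 + \<i> * of_real x) / (1 + \<i> * of_real y))
    - polylog 3 (of_real (y / x) * ((1 + \<i> * of_real x) / (1 + \<i> * of_real y)))"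
  define J where "J = 2 * polylog 3 (of_real (w / v)) - 2 * polylog 3 (of_real (- (w / v)))
      + ?D v w + ?D (- v) (- w) - ?D v (- w) - ?D (- v) w
      + ?L * (polylog 2 (of_real (w / v)) - polylog 2 (of_real (- (w / v))))
      + (?A v - ?A (- v)) * (?P w - ?P (- w)) + (?A w - ?A (- w)) * (?P v - ?P (- v))
      + \<i> * of_real pi / 2 * (?L * (?A w - ?A (- w)))
      - (Ln (of_real v) * ?A v - Ln (of_real v) * ?A (- v)) * (?A w - ?A (- w))"
  let ?g = "\<lambda>t. arctan (v * t) * arctan (w * t) / t"
  have int: "((\<lambda>t. complex_of_real (- 4 * ?g t)) has_integral J) {0..1}"
    using trilog_primitive[OF v le] unfolding J_def Li3_diff_def by (simp only: mult_1_right of_real_1 mult_1)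
  \<comment> \<open>Taking real parts gives the integrability of the real integrand, needed to
    evaluate \<open>T_fun\<close>; uniqueness of the integral then makes \<open>J\<close>
    real.\<close>
  have intR: "((\<lambda>t. - 4 * ?g t) has_integral Re J) {0..1}"
    using has_integral_Re[OF int] by (simp only: Re_complex_of_real)
  have "((\<lambda>t. complex_of_real (- 4 * ?g t)) has_integral of_real (Re J)) {0..1}"
    by (rule has_integral_of_real[OF intR])
  then have "J = of_real (Re J)" using int has_integral_unique by blast
  moreover have "- 4 * T_fun v w = Re J"
    using integral_unique[OF intR] unfolding T_fun_def by (simp only: integral_mult_right)
  ultimately have T: "complex_of_real (- 4 * T_fun v w) = J" by simp
  have atan: "?A x - ?A (- x) = 2 * \<i> * of_real (arctan x)" for x
    unfolding Ln_one_plus_ii by (simp add: arctan_minus)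
  have pos: "1 + v\<^sup>2 > 0" "1 + w\<^sup>2 > 0" by (intro add_pos_nonneg; simp)+
  have L: "?L = of_real (ln ((1 + v\<^sup>2) / (1 + w\<^sup>2)))"
    unfolding Ln_one_plus_ii using pos by (simp add: arctan_minus ln_div)
  have lnv: "Ln (of_real v) = of_real (ln v)" using v by (rule Ln_of_real)
  \<comment> \<open>These rewrites bring the arguments in the statement to the form
    \<open>1 + \<i> * of_real y\<close> or \<open>\<i> * of_real y\<close> used in
    \<open>J\<close>.\<close>
  have args: "of_real x * \<i> = \<i> * of_real x" "1 - \<i> * of_real x = 1 + \<i> * of_real (- x)"
    "- (\<i> * of_real x) = \<i> * of_real (- x)" for x
    by simp_all
  have quot: "(w * a) / (v * b) = of_real (w / v) * (a / b)"
    "- (of_real (w / v) * (a / b)) = of_real (- (w / v)) * (a / b)" for a b :: complex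
    by simp_all
  have ratios: "- w / - v = w / v" "- w / v = - (w / v)" "w / - v = - (w / v)" by simp_all
  have ln_atan: "Ln (of_real v) * ?A v - Ln (of_real v) * ?A (- v)
      = of_real (ln v) * (2 * \<i> * of_real (arctan v))"
    unfolding right_diff_distrib[symmetric] atan lnv ..
  \<comment> \<open>With the transcendental values abstracted to variables, the sides differ only by
    order and by \<open>\<i>\<close> squared being -1: for instance \<open>\<i> * p / 2\<close>
    times \<open>2 * \<i> * b\<close> is \<open>- p * b\<close>.\<close>
  have combine: "2 * r - 2 * r' + (p1 - q1) + (p2 - q2) - (p3 - q3) - (p4 - q4)
      + l * s + 2 * \<i> * a * m + 2 * \<i> * b * n + \<i> * p / 2 * (l * (2 * \<i> * b))
      - k * (2 * \<i> * a) * (2 * \<i> * b)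
    = 2 * r - 2 * r' + p2 + p1 - p3 - p4 - q2 - q1 + q3 + q4
      + l * s - 4 * a * (m / (2 * \<i>)) - 4 * b * (n / (2 * \<i>)) - p * l * b + 4 * k * a * b"
    for r r' p1 p2 p3 p4 q1 q2 q3 q4 l s a b m n k p :: complex
  proof -
    have "x / (2 * \<i>) = - \<i> * x / 2" for x by (simp add: field_simps)
    then show ?thesis by (simp add: algebra_simps)
  qed
  show ?thesis
    unfolding T args quot
    unfolding J_def ln_atan atan L ratios of_real_mult of_real_numeral
    by (rule combine)
qed

end
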